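(* Let $(G,X)$ be a $G$-system with $G$ a discrete infinite amenable group and $(X,d)$ a compact metric space, let $\mathcal{F}$ be a F{\o}lner net in $G$, and let $x\in X$. Suppose that $\mathcal{C}_{\mathcal{F}}(x)$ is not S-generic and that the almost periodic points of $(G,X)$ lying in $\mathcal{C}_{\mathcal{F}}(x)$ are dense in $\mathcal{C}_{\mathcal{F}}(x)$. Then there is an $\epsilon>0$ such that for every $a\in X$, every $\hat{x}\in\mathcal{C}_{\mathcal{F}}(x)$ and every neighborhood $U$ of $\hat{x}$ in $X$, there exist $y\in U$ and $g\in G$ with $d(ga,gy)\geq\epsilon$.
   Context: A $G$-system $(G,X)$: $G$ is a discrete infinite amenable group with identity $e$, $(X,d)$ is a compact metric space, and $G$ acts on $X$ from the left by continuous transformations ($ex=x$, $(gf)x=g(fx)$). A set $\Lambda\subseteq X$ is $G$-invariant if $g\Lambda\subseteq\Lambda$ for all $g\in G$. A subset $P\subseteq G$ is syndetic if there is a finite $F\subset G$ with $F^{-1}P=\bigcup_{g\in F}g^{-1}P=G$. A point $p\in X$ is almost periodic if $\{g\in G\mid gp\in U\}$ is syndetic for every neighborhood $U$ of $p$. A (left) F{\o}lner net in $G$ is a net $\mathcal{F}=\{F_n\}_{n\in D}$ of (nonempty) finite subsets of $G$ with $\lim_{n\in D}|gF_n\vartriangle F_n|/|F_n|=0$ for all $g\in G$. For $A\subseteq G$, $\overline{d}_{\mathcal{F}}(A)=\sup\{\alpha \mid \forall m\in D\ \exists n\ge m:\ |A\cap F_n|/|F_n|\ge\alpha\}$ and $\underline{d}_{\mathcal{F}}(A)=\sup\{\alpha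 \mid \exists m\in D\ \forall n\ge m:\ |A\cap F_n|/|F_n|\ge\alpha\}$; if they coincide the common value is $d_{\mathcal{F}}(A)$. A closed set $C\subseteq X$ is an $\mathcal{F}$-center of attraction of $x$ if $d_{\mathcal{F}}(\{g\in G\mid gx\in B_\epsilon(C)\})=1$ for all $\epsilon>0$, where $B_\epsilon(C)$ is the $\epsilon$-neighborhood of $C$. The minimal one (no proper subset of which is an $\mathcal{F}$-center of attraction of $x$), which exists and is unique, is denoted $\mathcal{C}_{\mathcal{F}}(x)$. A $G$-invariant set $\Lambda\subseteq X$ is S-generic (relative to $\mathcal{F}$) if there is $y\in\Lambda$ with $\Lambda=\mathcal{C}_{\mathcal{F}}(y)$. *)

theory Defs
  imports "HOL-Analysis.Analysis" "HOL-Algebra.Group_Action"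
begin

text \<open>Amenability of a discrete group: a left-invariant finitely additive probability measure
  exists on the family of all subsets.\<close>

definition amenable :: "('g, 'm) monoid_scheme \<Rightarrow> bool" where
  "amenable G \<longleftrightarrow> (\<exists>\<mu> :: 'g set \<Rightarrow> real.
     (\<forall>A. A \<subseteq> carrier G \<longrightarrow> 0 \<le> \<mu> A) \<and>
     \<mu> (carrier G) = 1 \<and>
     (\<forall>A B. A \<subseteq> carrier G \<longrightarrow> B \<subseteq> carrier G \<longrightarrow> A \<inter> B = {} \<longrightarrow> \<mu> (A \<union> B) = \<mu> A + \<mu> B) \<and>
     (\<forall>g\<in>carrier G. \<forall>A. A \<subseteq> carrier G \<longrightarrow> \<mu> (g <#\<^bsub>G\<^esub> A) = \<mu> A))"

text \<open>The compact metric space is the whole type. The laws \<open>ex = x\<close> and \<open>(gf)x = g(fx)\<close> are part of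
  the library's \<open>group_action\<close>.\<close>

definition G_system :: "('g, 'm) monoid_scheme \<Rightarrow> ('g \<Rightarrow> 'x::metric_space \<Rightarrow> 'x) \<Rightarrow> bool" where
  "G_system G \<phi> \<longleftrightarrow>
     group G \<and> infinite (carrier G) \<and> amenable G \<and>
     compact (UNIV :: 'x set) \<and>
     group_action G UNIV \<phi> \<and>
     (\<forall>g\<in>carrier G. continuous_on UNIV (\<phi> g))"

definition G_invariant ::
  "('g, 'm) monoid_scheme \<Rightarrow> ('g \<Rightarrow> 'x \<Rightarrow> 'x) \<Rightarrow> 'x set \<Rightarrow> bool" where
  "G_invariant G \<phi> \<Lambda> \<longleftrightarrow> (\<forall>g\<in>carrier G. \<phi> g ` \<Lambda> \<subseteq> \<Lambda>)"

definition syndetic :: "('g, 'm) monoid_scheme \<Rightarrow> 'g set \<Rightarrow> bool" where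
  "syndetic G P \<longleftrightarrow> P \<subseteq> carrier G \<and>
     (\<exists>F. finite F \<and> F \<subseteq> carrier G \<and> (\<Union>g\<in>F. inv\<^bsub>G\<^esub> g <#\<^bsub>G\<^esub> P) = carrier G)"

definition almost_periodic ::
  "('g, 'm) monoid_scheme \<Rightarrow> ('g \<Rightarrow> 'x::metric_space \<Rightarrow> 'x) \<Rightarrow> 'x \<Rightarrow> bool" where
  "almost_periodic G \<phi> p \<longleftrightarrow>
     (\<forall>U. p \<in> interior U \<longrightarrow> syndetic G {g \<in> carrier G. \<phi> g p \<in> U})"

text \<open>A net is a family \<open>F\<close> indexed by a set \<open>D\<close> with a relation \<open>r\<close>, where \<open>(m, n) \<in> r\<close> means
  \<open>m \<le> n\<close>.\<close>

definition directed_set :: "'d set \<Rightarrow> ('d \<times> 'd) set \<Rightarrow> bool" where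
  "directed_set D r \<longleftrightarrow> D \<noteq> {} \<and> preorder_on D r \<and>
     (\<forall>m\<in>D. \<forall>n\<in>D. \<exists>k\<in>D. (m, k) \<in> r \<and> (n, k) \<in> r)"

definition Folner_net ::
  "('g, 'm) monoid_scheme \<Rightarrow> 'd set \<Rightarrow> ('d \<times> 'd) set \<Rightarrow> ('d \<Rightarrow> 'g set) \<Rightarrow> bool" where
  "Folner_net G D r F \<longleftrightarrow>
     directed_set D r \<and>
     (\<forall>n\<in>D. finite (F n) \<and> F n \<noteq> {} \<and> F n \<subseteq> carrier G) \<and>
     (\<forall>g\<in>carrier G. \<forall>\<epsilon>>0. \<exists>m\<in>D. \<forall>n\<in>D. (m, n) \<in> r \<longrightarrow>
        real (card (sym_diff (g <#\<^bsub>G\<^esub> F n) (F n))) / real (card (F n)) < \<epsilon>)"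

definition upper_density ::
  "'d set \<Rightarrow> ('d \<times> 'd) set \<Rightarrow> ('d \<Rightarrow> 'g set) \<Rightarrow> 'g set \<Rightarrow> real" where
  "upper_density D r F A = Sup {\<alpha>. \<forall>m\<in>D. \<exists>n\<in>D. (m, n) \<in> r \<and>
     real (card (A \<inter> F n)) / real (card (F n)) \<ge> \<alpha>}"

definition lower_density ::
  "'d set \<Rightarrow> ('d \<times> 'd) set \<Rightarrow> ('d \<Rightarrow> 'g set) \<Rightarrow> 'g set \<Rightarrow> real" where
  "lower_density D r F A = Sup {\<alpha>. \<exists>m\<in>D. \<forall>n\<in>D. (m, n) \<in> r \<longrightarrow>
     real (card (A \<inter> F n)) / real (card (F n)) \<ge> \<alpha>}"

definition has_density ::
  "'d set \<Rightarrow> ('d \<times> 'd) set \<Rightarrow> ('d \<Rightarrow> 'g set) \<Rightarrow> 'g set \<Rightarrow> real \<Rightarrow> bool" where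
  "has_density D r F A \<delta> \<longleftrightarrow> upper_density D r F A = \<delta> \<and> lower_density D r F A = \<delta>"

text \<open>The \<open>\<epsilon>\<close>-neighborhood of \<open>C\<close> is the union of balls, hence empty for empty \<open>C\<close> (the condition
  \<open>infdist y C < \<epsilon>\<close> would give the whole space there).\<close>

definition center_of_attraction ::
  "('g, 'm) monoid_scheme \<Rightarrow> ('g \<Rightarrow> 'x::metric_space \<Rightarrow> 'x) \<Rightarrow>
   'd set \<Rightarrow> ('d \<times> 'd) set \<Rightarrow> ('d \<Rightarrow> 'g set) \<Rightarrow> 'x \<Rightarrow> 'x set \<Rightarrow> bool" where
  "center_of_attraction G \<phi> D r F x C \<longleftrightarrow> closed C \<and>
     (\<forall>\<epsilon>>0. has_density D r F {g \<in> carrier G. \<phi> g x \<in> (\<Union>c\<in>C. ball c \<epsilon>)} 1)"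

definition minimal_center ::
  "('g, 'm) monoid_scheme \<Rightarrow> ('g \<Rightarrow> 'x::metric_space \<Rightarrow> 'x) \<Rightarrow>
   'd set \<Rightarrow> ('d \<times> 'd) set \<Rightarrow> ('d \<Rightarrow> 'g set) \<Rightarrow> 'x \<Rightarrow> 'x set" where
  "minimal_center G \<phi> D r F x = (THE C. center_of_attraction G \<phi> D r F x C \<and>
     (\<forall>C'. C' \<subset> C \<longrightarrow> \<not> center_of_attraction G \<phi> D r F x C'))"

definition S_generic ::
  "('g, 'm) monoid_scheme \<Rightarrow> ('g \<Rightarrow> 'x::metric_space \<Rightarrow> 'x) \<Rightarrow>
   'd set \<Rightarrow> ('d \<times> 'd) set \<Rightarrow> ('d \<Rightarrow> 'g set) \<Rightarrow> 'x set \<Rightarrow> bool" where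
  "S_generic G \<phi> D r F \<Lambda> \<longleftrightarrow>
     G_invariant G \<phi> \<Lambda> \<and> (\<exists>y\<in>\<Lambda>. \<Lambda> = minimal_center G \<phi> D r F y)"

end

theory Submission
  imports Defs
begin

text \<open>The minimal center \<open>C\<close> of \<open>x\<close> consists of the points all of whose neighborhoods are visited
  by the orbit of \<open>x\<close> along a set of times that is not null; it is closed, invariant and contained
  in the orbit closure of \<open>x\<close>. Suppose that the conclusion fails for \<open>\<epsilon>\<close>, with \<open>a\<close>,
  \<open>x' \<in> C\<close> and \<open>U\<close>. Some \<open>hx\<close> lies in \<open>U\<close>, and \<open>g = h\<^sup>-\<^sup>1\<close> puts both \<open>x = g(hx)\<close> and
  \<open>gx' \<in> C\<close> within \<open>\<epsilon>\<close> of \<open>ga\<close>. Hence \<open>x\<close> is within \<open>2\<epsilon>\<close> of \<open>C\<close>. If this happens for every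
  \<open>\<epsilon>\<close>, then \<open>x \<in> C\<close>, and \<open>C\<close> is S-generic with \<open>x\<close> itself as a witness.\<close>

section \<open>Tails of a net, frequencies and null sets of times\<close>

definition net_filter :: "'d set \<Rightarrow> ('d \<times> 'd) set \<Rightarrow> 'd filter" where
  "net_filter D r = (INF m\<in>D. principal {n \<in> D. (m, n) \<in> r})"

definition frequency :: "('d \<Rightarrow> 'g set) \<Rightarrow> 'g set \<Rightarrow> 'd \<Rightarrow> real" where
  "frequency F A n = real (card (A \<inter> F n)) / real (card (F n))"

definition null_along :: "'d set \<Rightarrow> ('d \<times> 'd) set \<Rightarrow> ('d \<Rightarrow> 'g set) \<Rightarrow> 'g set \<Rightarrow> bool" where
  "null_along D r F A \<longleftrightarrow> (frequency F A \<longlongrightarrow> 0) (net_filter D r)"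

definition visits ::
  "('g, 'm) monoid_scheme \<Rightarrow> ('g \<Rightarrow> 'x \<Rightarrow> 'x) \<Rightarrow> 'x \<Rightarrow> 'x set \<Rightarrow> 'g set" where
  "visits G \<phi> x U = {g \<in> carrier G. \<phi> g x \<in> U}"

definition essential_limit_set ::
  "('g, 'm) monoid_scheme \<Rightarrow> ('g \<Rightarrow> 'x::metric_space \<Rightarrow> 'x) \<Rightarrow>
   'd set \<Rightarrow> ('d \<times> 'd) set \<Rightarrow> ('d \<Rightarrow> 'g set) \<Rightarrow> 'x \<Rightarrow> 'x set" where
  "essential_limit_set G \<phi> D r F x = {y. \<forall>e>0. \<not> null_along D r F (visits G \<phi> x (ball y e))}"

text \<open>Directedness and transitivity make the tails of the net a filter base, so an eventual
  property is one that holds on a whole tail. This makes the limit calculus for filters available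
  for nets.\<close>

lemma eventually_net_filter:
  assumes "directed_set D r"
  shows "eventually P (net_filter D r) \<longleftrightarrow> (\<exists>m\<in>D. \<forall>n\<in>D. (m, n) \<in> r \<longrightarrow> P n)"
proof -
  have dir: "D \<noteq> {}" "trans r" "\<And>m n. m \<in> D \<Longrightarrow> n \<in> D \<Longrightarrow> \<exists>k\<in>D. (m, k) \<in> r \<and> (n, k) \<in> r"
    using assms by (auto simp: directed_set_def preorder_on_def)
  have "\<exists>k\<in>D. principal {n \<in> D. (k, n) \<in> r} \<le>
      inf (principal {i \<in> D. (m, i) \<in> r}) (principal {i \<in> D. (n, i) \<in> r})"
    if "m \<in> D" "n \<in> D" for m n
  proof -
    obtain k where "k \<in> D" "(m, k) \<in> r" "(n, k) \<in> r" using dir(3)[OF \<open>m \<in> D\<close> \<open>n \<in> D\<close>] by blast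
    then show ?thesis
      using transD[OF dir(2)] by (intro bexI[of _ k]) auto
  qed
  then show ?thesis
    unfolding net_filter_def
    by (subst eventually_INF_base) (use dir(1) in \<open>auto simp: eventually_principal\<close>)
qed

text \<open>An index above both \<open>m\<close> and the threshold of the eventual property exists
  by directedness. This is what places every bound counted by the lower density among those counted
  by the upper density.\<close>

lemma net_filter_frequently:
  assumes "directed_set D r" "eventually P (net_filter D r)" "m \<in> D"
  shows "\<exists>n\<in>D. (m, n) \<in> r \<and> P n"
proof -
  obtain k where "k \<in> D" "\<And>n. n \<in> D \<Longrightarrow> (k, n) \<in> r \<Longrightarrow> P n"
    using assms(2) unfolding eventually_net_filter[OF assms(1)] by blast
  then show ?thesis
    using assms unfolding directed_set_def by metis
qed

section \<open>Density one as convergence of frequencies\<close>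

lemma frequency_nonneg: "0 \<le> frequency F A n"
  by (simp add: frequency_def)

lemma frequency_mono:
  assumes "finite (F n)" "A \<subseteq> B"
  shows "frequency F A n \<le> frequency F B n"
  unfolding frequency_def using assms
  by (intro divide_right_mono) (auto intro!: card_mono)

lemma frequency_le_1: "finite (F n) \<Longrightarrow> frequency F A n \<le> 1"
  unfolding frequency_def by (auto simp: divide_le_eq_1 card_gt_0_iff intro!: card_mono)

lemma frequency_compl:
  assumes "finite (F n)" "F n \<noteq> {}" "F n \<subseteq> S"
  shows "frequency F (S - A) n = 1 - frequency F A n"
proof -
  have "(S - A) \<inter> F n = F n - A \<inter> F n" using assms by blast
  moreover have "card (A \<inter> F n) \<le> card (F n)" using assms by (simp add: card_mono)
  ultimately show ?thesis
    using assms by (simp add: frequency_def card_Diff_subset of_nat_diff field_simps)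
qed

lemma Folner_netD:
  assumes "Folner_net G D r F"
  shows "directed_set D r"
    and "n \<in> D \<Longrightarrow> finite (F n)" and "n \<in> D \<Longrightarrow> F n \<noteq> {}" and "n \<in> D \<Longrightarrow> F n \<subseteq> carrier G"
  using assms by (auto simp: Folner_net_def)

lemma eventually_net_filter_in:
  assumes "directed_set D r"
  shows "\<forall>\<^sub>F n in net_filter D r. n \<in> D"
  using assms by (auto simp: eventually_net_filter directed_set_def)

text \<open>Frequencies never exceed 1, so lower density 1 already squeezes them to 1. Conversely,
  under convergence every number below 1 is an eventual lower bound, and both suprema are 1.\<close>

lemma has_density_1_iff:
  assumes net: "Folner_net G D r F"
  shows "has_density D r F A 1 \<longleftrightarrow> (frequency F A \<longlongrightarrow> 1) (net_filter D r)"
proof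
  note dir = Folner_netD(1)[OF net]
  note ev = eventually_net_filter[OF dir]
  note inD = eventually_net_filter_in[OF dir]
  let ?L = "{\<alpha>. \<forall>\<^sub>F n in net_filter D r. frequency F A n \<ge> \<alpha>}"
  let ?U = "{\<alpha>. \<forall>m\<in>D. \<exists>n\<in>D. (m, n) \<in> r \<and> frequency F A n \<ge> \<alpha>}"
  have low: "lower_density D r F A = Sup ?L"
    by (simp add: lower_density_def frequency_def ev)
  have upp: "upper_density D r F A = Sup ?U"
    by (simp add: upper_density_def frequency_def)
  obtain m0 where m0: "m0 \<in> D" using dir by (auto simp: directed_set_def)
  have LU: "?L \<subseteq> ?U"
    by (intro subsetI CollectI ballI net_filter_frequently[OF dir]) simp_all
  have U1: "\<alpha> \<le> 1" if \<alpha>: "\<alpha> \<in> ?U" for \<alpha>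
  proof -
    obtain n where "n \<in> D" "\<alpha> \<le> frequency F A n" using \<alpha> m0 by blast
    then show ?thesis using frequency_le_1 Folner_netD(2)[OF net] by (meson order_trans)
  qed
  show "(frequency F A \<longlongrightarrow> 1) (net_filter D r)" if "has_density D r F A 1"
  proof (rule order_tendstoI)
    fix a :: real assume "a < 1"
    moreover have "Sup ?L = 1" using that low by (simp add: has_density_def)
    \<comment> \<open>The bound 0 always qualifies, so the supremum is taken over a nonempty set and
      some member exceeds \<open>a\<close>.\<close>
    moreover have "?L \<noteq> {}" using frequency_nonneg[of F A] by (auto intro!: exI[of _ 0])
    ultimately obtain \<alpha> where "\<alpha> \<in> ?L" "a < \<alpha>" using less_cSupE[of a ?L] by auto
    then show "\<forall>\<^sub>F n in net_filter D r. a < frequency F A n"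
      by (auto elim: eventually_mono)
  next
    fix a :: real assume a: "1 < a"
    show "\<forall>\<^sub>F n in net_filter D r. frequency F A n < a"
      using inD by eventually_elim (meson a frequency_le_1 Folner_netD(2)[OF net] le_less_trans)
  qed
  show "has_density D r F A 1" if lim: "(frequency F A \<longlongrightarrow> 1) (net_filter D r)"
  proof -
    have L: "a \<in> ?L" if "a < 1" for a
      using order_tendstoD(1)[OF lim that] by (auto elim: eventually_mono)
    have "Sup ?L = 1"
    proof (rule cSup_eq)
      \<comment> \<open>The value 1 itself need not belong to the set; all reals below 1 do, which
        is enough.\<close>
      show "1 \<le> y" if "\<And>\<alpha>. \<alpha> \<in> ?L \<Longrightarrow> \<alpha> \<le> y" for y
        by (rule dense_le) (rule that[OF L])
    qed (rule U1[OF subsetD[OF LU]])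
    moreover have "Sup ?U = 1"
    proof (rule cSup_eq)
      show "1 \<le> y" if "\<And>\<alpha>. \<alpha> \<in> ?U \<Longrightarrow> \<alpha> \<le> y" for y
        by (rule dense_le) (rule that[OF subsetD[OF LU L]])
    qed (rule U1)
    ultimately show ?thesis by (simp add: has_density_def low upp)
  qed
qed

lemma has_density_1_iff_null_compl:
  assumes net: "Folner_net G D r F"
  shows "has_density D r F A 1 \<longleftrightarrow> null_along D r F (carrier G - A)"
proof -
  have compl: "\<forall>\<^sub>F n in net_filter D r. frequency F (carrier G - A) n = 1 - frequency F A n"
    using eventually_net_filter_in[OF Folner_netD(1)[OF net]]
    by eventually_elim (intro frequency_compl Folner_netD[OF net])
  have "null_along D r F (carrier G - A) \<longleftrightarrow> ((\<lambda>n. 1 - frequency F A n) \<longlongrightarrow> 0) (net_filter D r)"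
    unfolding null_along_def by (rule tendsto_cong[OF compl])
  also have "\<dots> \<longleftrightarrow> (frequency F A \<longlongrightarrow> 1) (net_filter D r)"
  proof
    assume "((\<lambda>n. 1 - frequency F A n) \<longlongrightarrow> 0) (net_filter D r)"
    from tendsto_diff[OF tendsto_const[of 1] this]
    show "(frequency F A \<longlongrightarrow> 1) (net_filter D r)" by simp
  next
    assume "(frequency F A \<longlongrightarrow> 1) (net_filter D r)"
    from tendsto_diff[OF tendsto_const[of 1] this]
    show "((\<lambda>n. 1 - frequency F A n) \<longlongrightarrow> 0) (net_filter D r)" by simp
  qed
  finally show ?thesis by (simp add: has_density_1_iff[OF net])
qed

section \<open>The ideal of null sets of times and its behaviour under translation\<close>

lemma null_alongI:
  assumes "\<forall>\<^sub>F n in net_filter D r. frequency F A n \<le> b n" "(b \<longlongrightarrow> 0) (net_filter D r)"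
  shows "null_along D r F A"
  unfolding null_along_def
  by (rule tendsto_sandwich[OF _ assms(1) tendsto_const assms(2)]) (simp add: frequency_nonneg)

lemma null_along_empty: "null_along D r F {}"
  by (rule null_alongI[where b = "\<lambda>_. 0"]) (simp_all add: frequency_def)

lemma null_along_mono:
  assumes net: "Folner_net G D r F" and "null_along D r F B" "A \<subseteq> B"
  shows "null_along D r F A"
proof (rule null_alongI)
  show "\<forall>\<^sub>F n in net_filter D r. frequency F A n \<le> frequency F B n"
    using eventually_net_filter_in[OF Folner_netD(1)[OF net]]
    by eventually_elim (intro frequency_mono Folner_netD[OF net] assms)
qed (use assms in \<open>simp add: null_along_def\<close>)

lemma null_along_Un:
  assumes "null_along D r F A" "null_along D r F B"
  shows "null_along D r F (A \<union> B)"
proof (rule null_alongI)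
  have "frequency F (A \<union> B) n \<le> frequency F A n + frequency F B n" for n
    unfolding frequency_def add_divide_distrib[symmetric] of_nat_add[symmetric]
    using card_Un_le[of "A \<inter> F n" "B \<inter> F n"]
    by (intro divide_right_mono) (simp_all add: Int_Un_distrib2 del: of_nat_add)
  then show "\<forall>\<^sub>F n in net_filter D r. frequency F (A \<union> B) n \<le> frequency F A n + frequency F B n"
    by simp
  show "((\<lambda>n. frequency F A n + frequency F B n) \<longlongrightarrow> 0) (net_filter D r)"
    using assms tendsto_add[of "frequency F A" 0 _ "frequency F B" 0]
    by (simp add: null_along_def)
qed

lemma null_along_UN:
  assumes "finite I" "\<And>i. i \<in> I \<Longrightarrow> null_along D r F (A i)"
  shows "null_along D r F (\<Union>i\<in>I. A i)"
  using assms by (induction I) (auto intro: null_along_Un null_along_empty)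

text \<open>Asymptotic invariance of the net enters here: left translation by \<open>h\<close>
  preserves cardinality, and \<open>h\<close> moves \<open>F n\<close> only by the symmetric
  difference, whose share of \<open>F n\<close> tends to 0.\<close>

lemma null_along_translate:
  assumes G: "group G" and net: "Folner_net G D r F" and h: "h \<in> carrier G"
    and A: "A \<subseteq> carrier G" and null: "null_along D r F (h <#\<^bsub>G\<^esub> A)"
  shows "null_along D r F A"
proof (rule null_alongI)
  interpret group G by fact
  define \<delta> where "\<delta> n = real (card (sym_diff (h <#\<^bsub>G\<^esub> F n) (F n))) / real (card (F n))" for n
  have "(\<delta> \<longlongrightarrow> 0) (net_filter D r)"
  proof (rule order_tendstoI)
    fix a :: real assume "a < 0"
    then show "\<forall>\<^sub>F n in net_filter D r. a < \<delta> n"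
      by (auto simp: \<delta>_def intro!: always_eventually less_le_trans[of a 0])
  next
    fix a :: real assume "0 < a"
    then show "\<forall>\<^sub>F n in net_filter D r. \<delta> n < a"
      using net h unfolding eventually_net_filter[OF Folner_netD(1)[OF net]] \<delta>_def
      by (simp add: Folner_net_def)
  qed
  from tendsto_add[OF null[unfolded null_along_def] this]
  show "((\<lambda>n. frequency F (h <#\<^bsub>G\<^esub> A) n + \<delta> n) \<longlongrightarrow> 0) (net_filter D r)" by simp
  show "\<forall>\<^sub>F n in net_filter D r. frequency F A n \<le> frequency F (h <#\<^bsub>G\<^esub> A) n + \<delta> n"
    using eventually_net_filter_in[OF Folner_netD(1)[OF net]]
  proof eventually_elim
    case (elim n)
    note Fn = Folner_netD(2,4)[OF net elim]
    have coset: "h <#\<^bsub>G\<^esub> B = (\<lambda>k. h \<otimes>\<^bsub>G\<^esub> k) ` B" for B by (auto simp: l_coset_def)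
    have inj: "inj_on (\<lambda>k. h \<otimes>\<^bsub>G\<^esub> k) (A \<inter> F n)"
      using h subsetD[OF A] by (auto simp: inj_on_def)
    have "card (A \<inter> F n) = card (h <#\<^bsub>G\<^esub> (A \<inter> F n))"
      unfolding coset by (rule card_image[OF inj, symmetric])
    \<comment> \<open>An element of \<open>h(A \<inter> F n)\<close> lies in \<open>hA\<close>; it
      is either in \<open>F n\<close> or in the part of \<open>h(F n)\<close> outside
      \<open>F n\<close>.\<close>
    also have "\<dots> \<le> card (((h <#\<^bsub>G\<^esub> A) \<inter> F n) \<union> sym_diff (h <#\<^bsub>G\<^esub> F n) (F n))"
      using Fn by (intro card_mono) (auto simp: coset)
    also have "\<dots> \<le> card ((h <#\<^bsub>G\<^esub> A) \<inter> F n) + card (sym_diff (h <#\<^bsub>G\<^esub> F n) (F n))"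
      by (rule card_Un_le)
    finally show ?case
      unfolding frequency_def \<delta>_def add_divide_distrib[symmetric] of_nat_add[symmetric]
      by (intro divide_right_mono) (simp_all del: of_nat_add)
  qed
qed

section \<open>The essential limit set is the minimal center, and it is invariant\<close>

lemma visits_mono: "U \<subseteq> V \<Longrightarrow> visits G \<phi> x U \<subseteq> visits G \<phi> x V"
  by (auto simp: visits_def)

lemma center_of_attraction_iff:
  assumes "Folner_net G D r F"
  shows "center_of_attraction G \<phi> D r F x C \<longleftrightarrow>
    closed C \<and> (\<forall>e>0. null_along D r F (visits G \<phi> x (- (\<Union>c\<in>C. ball c e))))"
proof -
  have "carrier G - {g \<in> carrier G. \<phi> g x \<in> V} = visits G \<phi> x (- V)" for V
    by (auto simp: visits_def)
  then show ?thesis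
    by (simp only: center_of_attraction_def has_density_1_iff_null_compl[OF assms])
qed

lemma closed_essential_limit_set:
  assumes "Folner_net G D r F"
  shows "closed (essential_limit_set G \<phi> D r F x)"
  unfolding closed_limpt
proof (intro allI impI)
  fix y assume lim: "y islimpt essential_limit_set G \<phi> D r F x"
  have "\<not> null_along D r F (visits G \<phi> x (ball y e))" if "e > 0" for e
  proof -
    obtain z where z: "z \<in> essential_limit_set G \<phi> D r F x" "dist z y < e / 2"
      using lim \<open>e > 0\<close> unfolding islimpt_approachable by (meson half_gt_zero)
    have "ball z (e / 2) \<subseteq> ball y e"
    proof
      fix w assume "w \<in> ball z (e / 2)"
      then show "w \<in> ball y e" using z(2) dist_triangle2[of y w z]
        by (simp add: dist_commute)
    qed
    then show ?thesis
      using z(1) \<open>e > 0\<close> null_along_mono[OF assms _ visits_mono]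
      unfolding essential_limit_set_def by (metis (mono_tags, lifting) half_gt_zero mem_Collect_eq)
  qed
  then show "y \<in> essential_limit_set G \<phi> D r F x" by (simp add: essential_limit_set_def)
qed

text \<open>A point outside the closed set \<open>C\<close> has a ball of radius \<open>e\<close>
  missing \<open>C\<close>. By the triangle inequality its ball of radius \<open>e / 2\<close>
  misses the \<open>e / 2\<close>-neighborhood of \<open>C\<close>, so it is visited only at a null
  set of times.\<close>

lemma essential_limit_set_subset_center:
  assumes net: "Folner_net G D r F" and "center_of_attraction G \<phi> D r F x C"
  shows "essential_limit_set G \<phi> D r F x \<subseteq> C"
proof
  fix y assume y: "y \<in> essential_limit_set G \<phi> D r F x"
  have C: "closed C" "\<And>e. e > 0 \<Longrightarrow> null_along D r F (visits G \<phi> x (- (\<Union>c\<in>C. ball c e)))"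
    using assms by (auto simp: center_of_attraction_iff)
  show "y \<in> C"
  proof (rule ccontr)
    assume "y \<notin> C"
    then obtain e where e: "e > 0" "ball y e \<subseteq> - C"
      using C(1) by (metis ComplI open_Compl open_contains_ball)
    have "ball y (e / 2) \<subseteq> - (\<Union>c\<in>C. ball c (e / 2))"
    proof clarsimp
      fix w c assume "dist y w * 2 < e" "c \<in> C" "dist c w * 2 < e"
      moreover from this have "dist y c < e" using dist_triangle2[of y c w] by simp
      ultimately show False using e(2) by auto
    qed
    then have "null_along D r F (visits G \<phi> x (ball y (e / 2)))"
      using e(1) by (intro null_along_mono[OF net C(2) visits_mono]) auto
    then show False using y e(1) by (auto simp: essential_limit_set_def)
  qed
qed

text \<open>Compactness turns a local statement into a global one: each point off the
  \<open>e\<close>-neighborhood has a ball with null visits, finitely many such balls cover the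
  complement, and finite unions of null sets are null.\<close>

lemma center_of_attraction_essential_limit_set:
  fixes \<phi> :: "'g \<Rightarrow> 'x::metric_space \<Rightarrow> 'x"
  assumes net: "Folner_net G D r F" and compact: "compact (UNIV :: 'x set)"
  shows "center_of_attraction G \<phi> D r F x (essential_limit_set G \<phi> D r F x)"
  unfolding center_of_attraction_iff[OF net]
proof (intro conjI allI impI closed_essential_limit_set[OF net])
  let ?K = "essential_limit_set G \<phi> D r F x"
  fix e :: real assume "e > 0"
  let ?S = "- (\<Union>c\<in>?K. ball c e)"
  have "compact ?S"
    by (rule compact_Int_closed[OF compact, of ?S, simplified Int_UNIV_left])
      (intro closed_Compl open_UN ballI open_ball)
  have "\<exists>d>0. null_along D r F (visits G \<phi> x (ball y d))" if "y \<in> ?S" for y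
  proof -
    have "y \<notin> ?K" using that \<open>e > 0\<close> centre_in_ball by blast
    then show ?thesis by (auto simp: essential_limit_set_def)
  qed
  then obtain d where d: "\<And>y. y \<in> ?S \<Longrightarrow> d y > 0"
    "\<And>y. y \<in> ?S \<Longrightarrow> null_along D r F (visits G \<phi> x (ball y (d y)))"
    by metis
  have "?S \<subseteq> (\<Union>y\<in>?S. ball y (d y))" using d(1) by force
  with \<open>compact ?S\<close> obtain T where T: "T \<subseteq> ?S" "finite T" "?S \<subseteq> (\<Union>y\<in>T. ball y (d y))"
    by (elim compactE_image[where f = "\<lambda>y. ball y (d y)"]) auto
  have "null_along D r F (\<Union>y\<in>T. visits G \<phi> x (ball y (d y)))"
    using T d(2) by (intro null_along_UN) auto
  then show "null_along D r F (visits G \<phi> x ?S)"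
    by (rule null_along_mono[OF net]) (use T(3) in \<open>unfold visits_def, blast\<close>)
qed

text \<open>The essential limit set is a center contained in every center. It is therefore the
  unique minimal one, and the definite description in \<open>minimal_center\<close> denotes
  it.\<close>

lemma minimal_center_eq:
  fixes \<phi> :: "'g \<Rightarrow> 'x::metric_space \<Rightarrow> 'x"
  assumes "Folner_net G D r F" and "compact (UNIV :: 'x set)"
  shows "minimal_center G \<phi> D r F x = essential_limit_set G \<phi> D r F x"
  unfolding minimal_center_def
  using center_of_attraction_essential_limit_set[OF assms]
    essential_limit_set_subset_center[OF assms(1)]
  by (intro the_equality) (blast, metis psubsetI)

text \<open>By continuity \<open>h\<close> carries a small ball around \<open>y\<close> into a given
  ball around \<open>hy\<close>. Visits to the small ball, translated by \<open>h\<close>, are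
  visits to the large one, so null visits near \<open>hy\<close> would force null visits near
  \<open>y\<close>.\<close>

lemma G_invariant_essential_limit_set:
  assumes sys: "G_system G \<phi>" and net: "Folner_net G D r F"
  shows "G_invariant G \<phi> (essential_limit_set G \<phi> D r F x)"
  unfolding G_invariant_def
proof clarify
  fix h y assume h: "h \<in> carrier G" and y: "y \<in> essential_limit_set G \<phi> D r F x"
  interpret group_action G UNIV \<phi> using sys by (simp add: G_system_def)
  have G: "group G" using sys by (simp add: G_system_def)
  show "\<phi> h y \<in> essential_limit_set G \<phi> D r F x"
    unfolding essential_limit_set_def
  proof (clarify)
    fix e :: real
    assume "e > 0" and null: "null_along D r F (visits G \<phi> x (ball (\<phi> h y) e))"
    have "continuous_on UNIV (\<phi> h)" using sys h by (simp add: G_system_def)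
    then obtain d where d: "d > 0" "\<And>z. dist y z < d \<Longrightarrow> dist (\<phi> h y) (\<phi> h z) < e"
      using \<open>e > 0\<close> unfolding continuous_on_iff by (metis UNIV_I dist_commute)
    have "h <#\<^bsub>G\<^esub> visits G \<phi> x (ball y d) \<subseteq> visits G \<phi> x (ball (\<phi> h y) e)"
      using d(2) h group.is_monoid[OF G] composition_rule
      by (auto simp: l_coset_def visits_def intro: monoid.m_closed)
    then have "null_along D r F (visits G \<phi> x (ball y d))"
      by (intro null_along_translate[OF G net h _ null_along_mono[OF net null]])
        (auto simp: visits_def)
    then show False using y d(1) by (auto simp: essential_limit_set_def)
  qed
qed

theorem theorem3p4:
  fixes G :: "('g, 'm) monoid_scheme"
    and \<phi> :: "'g \<Rightarrow> 'x::metric_space \<Rightarrow> 'x"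
    and D :: "'d set" and r :: "('d \<times> 'd) set" and F :: "'d \<Rightarrow> 'g set"
    and x :: 'x
  assumes "G_system G \<phi>"
    and "Folner_net G D r F"
    and "\<not> S_generic G \<phi> D r F (minimal_center G \<phi> D r F x)"
    and "minimal_center G \<phi> D r F x \<subseteq>
           closure {p \<in> minimal_center G \<phi> D r F x. almost_periodic G \<phi> p}"
  shows "\<exists>\<epsilon>>0. \<forall>a. \<forall>x'\<in>minimal_center G \<phi> D r F x. \<forall>U. x' \<in> interior U \<longrightarrow>
           (\<exists>y\<in>U. \<exists>g\<in>carrier G. dist (\<phi> g a) (\<phi> g y) \<ge> \<epsilon>)"
proof (rule ccontr)
  assume neg: "\<not> ?thesis"
  let ?K = "essential_limit_set G \<phi> D r F x"
  interpret group_action G UNIV \<phi> using assms(1) by (simp add: G_system_def)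
  have G: "group G" using assms(1) by (simp add: G_system_def)
  have K: "minimal_center G \<phi> D r F x = ?K"
    using assms(1,2) by (intro minimal_center_eq) (auto simp: G_system_def)
  have inv: "G_invariant G \<phi> ?K" by (rule G_invariant_essential_limit_set[OF assms(1,2)])
  have "\<exists>z\<in>?K. dist z x < e" if "e > 0" for e
  proof -
    \<comment> \<open>The failing bound is taken at \<open>e / 2\<close> because two distances to
      the orbit of \<open>a\<close> will be added.\<close>
    have "e / 2 > 0" using \<open>e > 0\<close> by simp
    then obtain a x' U where x': "x' \<in> ?K" and U: "x' \<in> interior U"
      and close: "\<And>y g. y \<in> U \<Longrightarrow> g \<in> carrier G \<Longrightarrow> dist (\<phi> g a) (\<phi> g y) < e / 2"
      using neg unfolding K by (meson not_le)
    obtain d where d: "d > 0" "ball x' d \<subseteq> U" using U by (meson mem_interior)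
    have "\<not> null_along D r F (visits G \<phi> x (ball x' d))"
      using x' d(1) by (simp add: essential_limit_set_def)
    \<comment> \<open>A set of times that is not null is in particular nonempty; one visit is all
      that is used.\<close>
    then have "visits G \<phi> x (ball x' d) \<noteq> {}" by (metis null_along_empty)
    then obtain h where h: "h \<in> carrier G" "\<phi> h x \<in> U"
      using d(2) by (auto simp: visits_def)
    let ?g = "inv\<^bsub>G\<^esub> h"
    have g: "?g \<in> carrier G" using G h(1) by (rule group.inv_closed)
    have gh: "\<phi> ?g (\<phi> h x) = x" by (rule orbit_sym_aux[OF h(1) _ refl]) simp
    have "x' \<in> U" using U interior_subset by blast
    \<comment> \<open>Both \<open>hx\<close> and \<open>x'\<close> lie in \<open>U\<close>, so their
      images under \<open>?g\<close> are within \<open>e / 2\<close> of the image of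
      \<open>a\<close>; the image of \<open>hx\<close> is \<open>x\<close>.\<close>
    then have "dist (\<phi> ?g x') x < e"
      using close[OF h(2) g] close[OF _ g, of x'] dist_triangle3[of "\<phi> ?g x'" x "\<phi> ?g a"]
      by (simp add: gh)
    moreover have "\<phi> ?g x' \<in> ?K" using inv g x' by (auto simp: G_invariant_def)
    ultimately show ?thesis by blast
  qed
  then have "x \<in> ?K"
    using closed_approachable[OF closed_essential_limit_set[OF assms(2)]] by blast
  then have "S_generic G \<phi> D r F ?K"
    using inv K unfolding S_generic_def by metis
  then show False using assms(3) K by simp
qed

end
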